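(* Let $\mathrm{v}=1$, $0<a<1$, $w:=\lceil 1/a\rceil$, $\gamma_1:=(1+w)^{-1}$, $\gamma_2:=1/2$. There exist a regular configuration $x\in X$ with $\gamma_1<\rho(x)<\gamma_2$ and constants $0<A<B<\infty$ such that if a configuration $y\in X$ differs from $x$ at most at $A$ sites in any segment of length $B$, then $y$ is also regular. (In other words, there is an open neighborhood of the configuration $x$ consisting only of configurations corresponding to the lower branch of the fundamental diagram.)
   Context: Model. Fix an acceleration $a>0$ and maximal velocity $\mathrm{v}$ (here $\mathrm{v}=1$). A configuration is $x=\{x_i\}_{i\in\mathbb Z}$; $x_i\ge 0$ means that there is a particle at site $i$ with velocity $x_i$, and $x_i=-1$ means that site $i$ is a hole. For a configuration and $i\in\mathbb Z$, $i_-\le i$ is the site of the closest particle at or to the left of $i$, and $i_+>i$ is the site of the closest particle strictly to the right of $i$ ($i_+=+\infty$ if there is none). The configuration is admissible if $x_i\in[0,\mathrm{v}]\cup\{-1\}$ and $i_-+x_{i_-}<i_+$ for all $i$ (whenever $i_-$ exists); $X$ is the set of admissible configurations, always assumed to contain at least one particle. The dynamics is $T=\mathcal A\circ\sigma:X\to X$ with $(\sigma x)_i=x_{i_-}$ if $i_-+\lfloor x_{i_-}\rfloor=i$ and $(\sigma x)_i=-1$ otherwise; $(\mathcal A x)_i=\min\{x_i+a,\ i_+-i-1,\ \mathrm{v}\}$ if $x_i\ge0$ and $(\mathcal A x)_i=-1$ otherwise ($i_+$ computed in the configuration to which $\mathcal A$ is applied). Densities. $\rho(x[n,m])$ is the number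 of particles at sites $n,\dots,m$ divided by $m-n+1$; $\rho(x)=\lim_{n\to\infty}\rho(x[1,n])$ when the limit exists. Jams ($\mathrm{v}=1$). A segment $x[n,m]$, $n\le m$, is a jam if $0\le x_i<1$ for $n\le i\le m$, $x_{n-1}<0$ and $|x_{m+1}|\ge1$; the particle at $m$ is its leading particle. The particles in a jam change with time: leading particles become free (upon reaching velocity 1) and new particles join the jam from behind; a jam cannot split into several jams. $J(t)$ denotes the segment corresponding to the given jam $J=J(0)$ at time $t$, $|J(t)|$ its length, and the life-time of $J$ is $\tau(J):=\sup\{t>0:\ |J(t)|>0\}$. (If a particle that has not joined $J$ is stopped, at time $\tau(J)+1$, by the last particle of $J$, which has just got velocity 1 but has not started moving yet, then $J$ has already ceased to exist and the stopped particle creates a new jam.) The basin of attraction of $J=x[n,m]$ is the segment $x[k,m]$, $k\le n\le m$, containing all particles which will eventually at positive time join the jam or can be stopped by a particle from $J$ during the time $\tau(J)+1$; $k=-\infty$ is possible. Having an infinite basin of attraction and having an infinite life-time ($|J(t)|>0$ for all $t\ge0$) are treated as the same property. Ultimately jammed. Configurations $x,y\in X$ are equivalent if there is $k$ with $x_i=y_i$ for all $i\ge k$. A configuration $x\in X$ is ultimately jammed if some configuration equivalent to it has, for every $n\in\mathbb Z$, a jam with infinite basin of attraction located at time $0$ to the right of site $n$. As the motion of a particle does not depend on the particles to its left, for an ultimately jammed configuration one assumes (to simplify notation) that all sites with nonpositive numbers are occupied by particles with zero velocity. Among configurations with densities in $(\gamma_1,\gamma_2)$, the lower branch of the fundamental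 diagram corresponds to the ultimately jammed ones and the upper branch to those that are not. Regularity. When a particle moves from site $i$ to site $i+1$ it exchanges positions with (meets) the hole at $i+1$, which moves to $i$. A hole initially at a site $j$ to the right of an infinite life-time jam, after a finite transient period, moves periodically, one position to the left exactly once per $w$ time steps; $\vartheta_j$ is the duration of the transient period, $K_j$ is the number of particles the hole meets during it, and $D_j:=K_j-\vartheta_j/w$ is the defect. If $\{j_k\}$ are the nonnegative initial positions of holes in an ultimately jammed $x$, then $\mathrm{Reg}(x):=\limsup_{j_k\to\infty}|D_{j_k}|/j_k$. A configuration is regular if it is ultimately jammed and $\mathrm{Reg}(x)=0$. *)

theory Defs
  imports "HOL-Analysis.Analysis"
begin

section \<open>The model, with maximal velocity 1\<close>

text \<open>
  A configuration maps every site to the velocity of the particle there, or to -1 for a hole.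
\<close>

type_synonym config = "int \<Rightarrow> real"

abbreviation (input) vmax :: real where
  "vmax \<equiv> 1"

definition occupied :: "config \<Rightarrow> int \<Rightarrow> bool" where
  "occupied x i \<longleftrightarrow> 0 \<le> x i"

text \<open>
  The sites \<open>i\<^sub>-\<close> (closest particle at or to the left of i) and \<open>i\<^sub>+\<close> (closest particle strictly to
  the right of i). Each is meaningful only if such a particle exists, which is why every use
  below is guarded by \<open>has_left\<close> or \<open>has_right\<close>.
\<close>

definition has_left :: "config \<Rightarrow> int \<Rightarrow> bool" where
  "has_left x i \<longleftrightarrow> (\<exists>j\<le>i. occupied x j)"

definition has_right :: "config \<Rightarrow> int \<Rightarrow> bool" where
  "has_right x i \<longleftrightarrow> (\<exists>j>i. occupied x j)"

definition left_site :: "config \<Rightarrow> int \<Rightarrow> int" where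
  "left_site x i = (GREATEST j. j \<le> i \<and> occupied x j)"

definition right_site :: "config \<Rightarrow> int \<Rightarrow> int" where
  "right_site x i = (LEAST j. i < j \<and> occupied x j)"

definition admissible :: "config set" where
  "admissible = {x.
     (\<forall>i. x i \<in> {0..vmax} \<union> {-1}) \<and>
     (\<forall>i. has_left x i \<and> has_right x i \<longrightarrow>
        real_of_int (left_site x i) + x (left_site x i) < real_of_int (right_site x i)) \<and>
     (\<exists>i. occupied x i)}"

definition shift :: "config \<Rightarrow> config" where
  "shift x i =
     (if has_left x i \<and> left_site x i + \<lfloor>x (left_site x i)\<rfloor> = i
      then x (left_site x i) else -1)"

text \<open>If there is no particle to the right, \<open>i\<^sub>+\<close> is infinite and drops out of the minimum.\<close>

definition accelerate :: "real \<Rightarrow> config \<Rightarrow> config" where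
  "accelerate a x i =
     (if occupied x i then
        (if has_right x i
         then Min {x i + a, real_of_int (right_site x i - i - 1), vmax}
         else min (x i + a) vmax)
      else -1)"

definition step :: "real \<Rightarrow> config \<Rightarrow> config" where
  "step a = accelerate a \<circ> shift"

definition state :: "real \<Rightarrow> config \<Rightarrow> nat \<Rightarrow> config" where
  "state a x t = (step a ^^ t) x"

fun particle_pos :: "real \<Rightarrow> config \<Rightarrow> int \<Rightarrow> nat \<Rightarrow> int" where
  "particle_pos a x i 0 = i"
| "particle_pos a x i (Suc t) =
     particle_pos a x i t + \<lfloor>state a x t (particle_pos a x i t)\<rfloor>"

text \<open>A hole exchanges positions with the particle moving into it.\<close>

fun hole_pos :: "real \<Rightarrow> config \<Rightarrow> int \<Rightarrow> nat \<Rightarrow> int" where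
  "hole_pos a x j 0 = j"
| "hole_pos a x j (Suc t) =
     (if \<lfloor>state a x t (hole_pos a x j t - 1)\<rfloor> = 1
      then hole_pos a x j t - 1 else hole_pos a x j t)"

definition seg_density :: "config \<Rightarrow> int \<Rightarrow> int \<Rightarrow> real" where
  "seg_density x n m = real (card {i \<in> {n..m}. occupied x i}) / real_of_int (m - n + 1)"

definition has_density :: "config \<Rightarrow> real \<Rightarrow> bool" where
  "has_density x \<rho> \<longleftrightarrow> (\<lambda>n. seg_density x 1 (int n)) \<longlonglongrightarrow> \<rho>"

definition period :: "real \<Rightarrow> nat" where
  "period a = nat \<lceil>1 / a\<rceil>"

section \<open>Jams\<close>

definition is_jam :: "config \<Rightarrow> int \<Rightarrow> int \<Rightarrow> bool" where
  "is_jam x n m \<longleftrightarrow>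
     n \<le> m \<and> (\<forall>i\<in>{n..m}. 0 \<le> x i \<and> x i < 1) \<and> x (n - 1) < 0 \<and> \<bar>x (m + 1)\<bar> \<ge> 1"

text \<open>
  The set of sites of the segment \<open>J(t)\<close> for the jam \<open>J = x[n,m]\<close>. The particles of a jam have
  velocity less than 1, so in the next step they keep their sites: the jam at time t + 1 is the one
  containing some particle of \<open>J(t)\<close>. If there is none, then the jam has ceased to exist;
  in particular, a particle stopped by the last particle of the jam, which has just got velocity 1,
  does not prolong the jam.
\<close>

fun jam_at :: "real \<Rightarrow> config \<Rightarrow> int \<Rightarrow> int \<Rightarrow> nat \<Rightarrow> int set" where
  "jam_at a x n m 0 = {n..m}"
| "jam_at a x n m (Suc t) =
     \<Union> {{n'..m'} | n' m'. is_jam (state a x (Suc t)) n' m' \<and>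
                            {n'..m'} \<inter> jam_at a x n m t \<noteq> {}}"

definition life_time :: "real \<Rightarrow> config \<Rightarrow> int \<Rightarrow> int \<Rightarrow> enat" where
  "life_time a x n m = Sup {enat t | t. t > 0 \<and> card (jam_at a x n m t) > 0}"

definition joins :: "real \<Rightarrow> config \<Rightarrow> int \<Rightarrow> int \<Rightarrow> int \<Rightarrow> bool" where
  "joins a x n m i \<longleftrightarrow> (\<exists>t>0. particle_pos a x i t \<in> jam_at a x n m t)"

text \<open>
  A particle is stopped at time t + 1 by a particle of the jam if it then has velocity 0 and the
  site in front of it is the site of a particle belonging to the jam at time t (which cannot
  have moved in between).
\<close>

definition stopped_by :: "real \<Rightarrow> config \<Rightarrow> int \<Rightarrow> int \<Rightarrow> int \<Rightarrow> bool" where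
  "stopped_by a x n m i \<longleftrightarrow>
     (\<exists>t. enat (Suc t) \<le> life_time a x n m + 1 \<and>
          state a x (Suc t) (particle_pos a x i (Suc t)) = 0 \<and>
          particle_pos a x i (Suc t) + 1 \<in> jam_at a x n m t)"

text \<open>
  The basin of attraction, as a set of sites: the smallest segment, possibly unbounded to the
  left, with right end m that contains the jam and all particles attracted by it.
\<close>

definition basin :: "real \<Rightarrow> config \<Rightarrow> int \<Rightarrow> int \<Rightarrow> int set" where
  "basin a x n m =
     {i. i \<le> m \<and>
         (n \<le> i \<or> (\<exists>j\<le>i. occupied x j \<and> (joins a x n m j \<or> stopped_by a x n m j)))}"

definition equivalent :: "config \<Rightarrow> config \<Rightarrow> bool" where
  "equivalent x y \<longleftrightarrow> (\<exists>k. \<forall>i\<ge>k. x i = y i)"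

definition ultimately_jammed :: "real \<Rightarrow> config \<Rightarrow> bool" where
  "ultimately_jammed a x \<longleftrightarrow>
     x \<in> admissible \<and>
     (\<exists>y\<in>admissible. equivalent x y \<and>
        (\<forall>k. \<exists>n m. k < n \<and> is_jam y n m \<and> infinite (basin a y n m)))"

section \<open>Regularity\<close>

text \<open>
  The standing normalization for ultimately jammed configurations: all nonpositive
  sites are occupied by particles with velocity 0. Regularity is evaluated after it.
\<close>

definition normalized :: "config \<Rightarrow> config" where
  "normalized x i = (if i \<le> 0 then 0 else x i)"

text \<open>
  The transient period of a hole ends at the first time from which on every time
  interval of \<open>period a\<close> steps contains exactly one move of the hole.
\<close>

definition transient :: "real \<Rightarrow> config \<Rightarrow> int \<Rightarrow> nat" where
  "transient a x j =
     (LEAST s. \<forall>t\<ge>s. hole_pos a x j (t + period a) = hole_pos a x j t - 1)"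

definition met_particles :: "real \<Rightarrow> config \<Rightarrow> int \<Rightarrow> nat" where
  "met_particles a x j =
     card {t. t < transient a x j \<and> hole_pos a x j (Suc t) \<noteq> hole_pos a x j t}"

definition defect :: "real \<Rightarrow> config \<Rightarrow> int \<Rightarrow> real" where
  "defect a x j = real (met_particles a x j) - real (transient a x j) / real (period a)"

definition Reg :: "real \<Rightarrow> config \<Rightarrow> ereal" where
  "Reg a x =
     Limsup (inf at_top (principal {j. 0 \<le> j \<and> \<not> occupied (normalized x) j}))
       (\<lambda>j. ereal (\<bar>defect a (normalized x) j\<bar> / real_of_int j))"

definition regular :: "real \<Rightarrow> config \<Rightarrow> bool" where
  "regular a x \<longleftrightarrow> ultimately_jammed a x \<and> Reg a x = 0"

end

theory Submission
  imports Defs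
begin

text \<open>
  A hole acts as a server and the maximal cluster of particles to its left as its queue: a particle
  that meets the hole enters the queue of the next hole on the right. A queueing particle is served
  in \<open>w\<close> steps, a particle that finds the queue empty in one step. Since all
  nonpositive sites of a normalized configuration are occupied, the leftmost hole has an infinite
  queue and serves with period \<open>w\<close>, and periodicity propagates from each hole to the next one
  within \<open>3 * w\<close> steps.

  The delay of the service at a hole grows by \<open>1\<close> per hole to its left and drops by \<open>w\<close> per
  particle, so it stays bounded as soon as every period contains sufficiently many particles. A
  cluster that is long compared with the delay of its input is never exhausted: it is a jam with
  infinite life-time, and its hole is periodic from the start. If such jams occur with bounded
  gaps, then all transient periods are bounded, so that all defects are bounded. Alternating 20
  standing particles with 21 holes gives enough slack to absorb one changed site in every 82.
\<close>

section \<open>The local update rule\<close>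

text \<open>Since velocities are at most 1 and sites are integers, the spacing condition of
  \<open>admissible\<close> can fail only at velocity exactly 1, so it reduces to a condition on
  neighbouring sites. Existence of a particle is left out; it enters only when returning to
  \<open>admissible\<close>.\<close>

definition valid :: "config \<Rightarrow> bool" where
  "valid x \<longleftrightarrow> (\<forall>i. (x i = -1 \<or> 0 \<le> x i \<and> x i \<le> 1) \<and> (x i = 1 \<longrightarrow> x (i + 1) = -1))"

lemma validD:
  assumes "valid x"
  shows "x i = -1 \<or> 0 \<le> x i" "x i \<le> 1" "x i = 1 \<Longrightarrow> x (i + 1) = -1"
  using assms unfolding valid_def by (blast, smt (verit), blast)

lemma int_Greatest:
  fixes P :: "int \<Rightarrow> bool"
  assumes "P j" "j \<le> b" "\<And>k. P k \<Longrightarrow> k \<le> b"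
  shows "P (GREATEST k. P k)" "\<And>k. P k \<Longrightarrow> k \<le> (GREATEST k. P k)"
proof -
  define Q where "Q n \<longleftrightarrow> P (b - int n)" for n
  have "Q (nat (b - j))" using assms(1,2) by (simp add: Q_def)
  then have Q: "Q (LEAST n. Q n)" and L: "\<And>n. Q n \<Longrightarrow> (LEAST n. Q n) \<le> n"
    by (auto intro: LeastI Least_le)
  define m where "m = b - int (LEAST n. Q n)"
  have Pm: "P m" using Q by (simp add: Q_def m_def)
  have ub: "k \<le> m" if "P k" for k
    using L[of "nat (b - k)"] that assms(3)[OF that] by (simp add: Q_def m_def)
  have "(GREATEST k. P k) = m"
    by (rule Greatest_equality) (use Pm ub in auto)
  then show "P (GREATEST k. P k)" "\<And>k. P k \<Longrightarrow> k \<le> (GREATEST k. P k)"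
    using Pm ub by auto
qed

lemma int_Least:
  fixes P :: "int \<Rightarrow> bool"
  assumes "P j" "\<And>k. P k \<Longrightarrow> b \<le> k"
  shows "P (LEAST k. P k)" "\<And>k. P k \<Longrightarrow> (LEAST k. P k) \<le> k"
proof -
  define Q where "Q n \<longleftrightarrow> P (b + int n)" for n
  have "Q (nat (j - b))" using assms(1) assms(2)[OF assms(1)] by (simp add: Q_def)
  then have Q: "Q (LEAST n. Q n)" and L: "\<And>n. Q n \<Longrightarrow> (LEAST n. Q n) \<le> n"
    by (auto intro: LeastI Least_le)
  define m where "m = b + int (LEAST n. Q n)"
  have Pm: "P m" using Q by (simp add: Q_def m_def)
  have lb: "m \<le> k" if "P k" for k
    using L[of "nat (k - b)"] that assms(2)[OF that] by (simp add: Q_def m_def)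
  have "(LEAST k. P k) = m"
    by (rule Least_equality) (use Pm lb in auto)
  then show "P (LEAST k. P k)" "\<And>k. P k \<Longrightarrow> (LEAST k. P k) \<le> k"
    using Pm lb by auto
qed

lemma left_site:
  assumes "has_left x i"
  shows "left_site x i \<le> i" "occupied x (left_site x i)"
    "\<And>k. k \<le> i \<Longrightarrow> occupied x k \<Longrightarrow> k \<le> left_site x i"
proof -
  from assms obtain j where j: "j \<le> i \<and> occupied x j" by (auto simp: has_left_def)
  show "left_site x i \<le> i" "occupied x (left_site x i)"
    using int_Greatest(1)[where P = "\<lambda>k. k \<le> i \<and> occupied x k", OF j, of i] j
    by (auto simp: left_site_def)
  show "k \<le> left_site x i" if "k \<le> i" "occupied x k" for k
    using int_Greatest(2)[where P = "\<lambda>k. k \<le> i \<and> occupied x k", OF j, of i k] j that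
    by (auto simp: left_site_def)
qed

lemma right_site:
  assumes "has_right x i"
  shows "i < right_site x i" "occupied x (right_site x i)"
    "\<And>k. i < k \<Longrightarrow> occupied x k \<Longrightarrow> right_site x i \<le> k"
proof -
  from assms obtain j where j: "i < j \<and> occupied x j" by (auto simp: has_right_def)
  show "i < right_site x i" "occupied x (right_site x i)"
    using int_Least(1)[where P = "\<lambda>k. i < k \<and> occupied x k", OF j, of i] by (auto simp: right_site_def)
  show "right_site x i \<le> k" if "i < k" "occupied x k" for k
    using int_Least(2)[where P = "\<lambda>k. i < k \<and> occupied x k", OF j, of i k] that
    by (auto simp: right_site_def)
qed

lemma admissible_imp_valid:
  assumes "x \<in> admissible"
  shows "valid x"
  unfolding valid_def
proof (intro allI conjI impI)
  fix i
  have r: "x i \<in> {0..1} \<union> {-1}" for i using assms by (simp add: admissible_def)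
  show "x i = -1 \<or> 0 \<le> x i \<and> x i \<le> 1" using r[of i] by auto
  assume 1: "x i = 1"
  show "x (i + 1) = -1"
  proof (rule ccontr)
    assume "x (i + 1) \<noteq> -1"
    then have o: "occupied x (i + 1)" using r[of "i + 1"] by (auto simp: occupied_def)
    have oi: "occupied x i" using 1 by (simp add: occupied_def)
    have h: "has_left x i" "has_right x i"
      unfolding has_left_def has_right_def using o oi by (metis order_refl, metis less_add_one)
    have "left_site x i = i" using left_site[OF h(1)] oi by (meson order_antisym order_refl)
    moreover have "right_site x i = i + 1"
      using right_site[OF h(2)] o by (smt (verit))
    ultimately show False using assms h 1 by (auto simp: admissible_def)
  qed
qed

lemma valid_imp_admissible:
  assumes "valid x" "occupied x j"
  shows "x \<in> admissible"
  unfolding admissible_def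
proof (intro CollectI conjI allI impI)
  fix i
  show "x i \<in> {0..1} \<union> {-1}" using validD[OF assms(1), of i] by auto
  assume "has_left x i \<and> has_right x i"
  then have l: "has_left x i" and r: "has_right x i" by auto
  let ?l = "left_site x i" let ?r = "right_site x i"
  have "?l < ?r" using left_site(1)[OF l] right_site(1)[OF r] by simp
  have "?r \<noteq> ?l + 1" if "x ?l = 1"
    using validD(3)[OF assms(1) that] right_site(2)[OF r] by (auto simp: occupied_def)
  then show "real_of_int ?l + x ?l < real_of_int ?r"
    using validD(2)[OF assms(1), of ?l] \<open>?l < ?r\<close> by (cases "x ?l = 1") linarith+
qed (use assms(2) in blast)

text \<open>Describes the sites occupied between the two halves of a step: a slow particle has kept
  its site, or a particle of velocity 1 has arrived from the left.\<close>

definition settled :: "config \<Rightarrow> int \<Rightarrow> bool" where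
  "settled x i \<longleftrightarrow> 0 \<le> x i \<and> x i < 1 \<or> x (i - 1) = 1"

lemma shift_eq:
  assumes "valid x"
  shows "shift x i = (if x (i - 1) = 1 then 1 else if 0 \<le> x i \<and> x i < 1 then x i else -1)"
proof -
  note v = validD[OF assms]
  have fl: "\<lfloor>x k\<rfloor> = (if x k = 1 then 1 else 0)" if "occupied x k" for k
    using v(2)[of k] that by (auto simp: occupied_def floor_eq_iff)
  consider "occupied x i" | "\<not> occupied x i" "occupied x (i - 1)"
    | "\<not> occupied x i" "\<not> occupied x (i - 1)" by blast
  then show ?thesis
  proof cases
    case 1
    then have l: "has_left x i" unfolding has_left_def by blast
    have "left_site x i = i" using left_site[OF l] 1 by (meson order_antisym order_refl)
    moreover have "x (i - 1) \<noteq> 1" using v(3)[of "i - 1"] 1 by (auto simp: occupied_def)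
    ultimately show ?thesis
      using l fl[OF 1] 1 v(2)[of i] unfolding shift_def by (auto simp: occupied_def)
  next
    case 2
    then have l: "has_left x i" unfolding has_left_def by (metis diff_le_self zle_diff1_eq less_imp_le diff_add_cancel zless_add1_eq)
    have "left_site x i = i - 1"
      using left_site(1,2)[OF l] left_site(3)[OF l _ 2(2)] 2(1) by (cases "left_site x i = i") auto
    then show ?thesis
      using l fl[OF 2(2)] 2 unfolding shift_def by (auto simp: occupied_def)
  next
    case 3
    have "left_site x i + \<lfloor>x (left_site x i)\<rfloor> \<noteq> i" if l: "has_left x i"
    proof -
      have "left_site x i \<noteq> i" "left_site x i \<noteq> i - 1"
        using left_site(2)[OF l] 3 by metis+
      then show ?thesis using left_site(1)[OF l] fl[OF left_site(2)[OF l]] by auto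
    qed
    then show ?thesis using 3 unfolding shift_def by (auto simp: occupied_def)
  qed
qed

lemma occupied_shift:
  assumes "valid x"
  shows "occupied (shift x) i \<longleftrightarrow> settled x i"
  by (auto simp: occupied_def settled_def shift_eq[OF assms])

text \<open>After \<open>shift\<close> the free space ahead is either 0, which forces velocity 0, or
  at least 1, where the bound by the gap is subsumed under the maximal velocity. Hence the search
  for the next particle disappears from the rule.\<close>

lemma step_eq:
  assumes "valid x" "0 < a"
  shows "step a x i =
    (if \<not> settled x i then -1 else if settled x (i + 1) then 0
     else min 1 ((if x (i - 1) = 1 then 1 else x i) + a))"
proof (cases "settled x i")
  case False
  then show ?thesis by (simp add: step_def accelerate_def occupied_shift[OF assms(1)])
next
  case True
  let ?s = "shift x"
  have v: "?s i = (if x (i - 1) = 1 then 1 else x i)" "0 \<le> ?s i"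
    using True by (auto simp: settled_def shift_eq[OF assms(1)])
  have o: "occupied ?s k \<longleftrightarrow> settled x k" for k by (rule occupied_shift[OF assms(1)])
  show ?thesis
  proof (cases "settled x (i + 1)")
    case t: True
    then have r: "has_right ?s i" unfolding has_right_def using o by (metis less_add_one)
    have "right_site ?s i = i + 1" using right_site[OF r] t o by (smt (verit))
    then show ?thesis using True t r o v assms(2) by (simp add: step_def accelerate_def)
  next
    case f: False
    have "right_site ?s i \<ge> i + 2" if r: "has_right ?s i"
    proof -
      have "right_site ?s i \<noteq> i + 1" using right_site(2)[OF r] f o by metis
      then show ?thesis using right_site(1)[OF r] by simp
    qed
    then have "1 \<le> real_of_int (right_site ?s i - i - 1)" if "has_right ?s i"
      using that by fastforce
    then have "accelerate a ?s i = min 1 (?s i + a)"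
      using True o by (cases "has_right ?s i") (auto simp: accelerate_def min_def)
    then show ?thesis using True f v(1) by (simp add: step_def)
  qed
qed

lemma valid_step:
  assumes "valid x" "0 < a"
  shows "valid (step a x)"
proof -
  have "(step a x i = -1 \<or> 0 \<le> step a x i \<and> step a x i \<le> 1)
    \<and> (step a x i = 1 \<longrightarrow> step a x (i + 1) = -1)" for i
  proof (cases "settled x i \<and> \<not> settled x (i + 1)")
    case True
    then have "0 \<le> (if x (i - 1) = 1 then 1 else x i)" by (auto simp: settled_def)
    then show ?thesis using True assms(2) by (simp add: step_eq[OF assms] min_def)
  next
    case False
    then show ?thesis by (auto simp: step_eq[OF assms])
  qed
  then show ?thesis by (simp add: valid_def)
qed

section \<open>Holes as servers of a tandem queue\<close>

locale traffic =
  fixes a :: real and x :: config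
  assumes a: "0 < a" "a < 1" and valid_init: "valid x"
begin

abbreviation "S \<equiv> state a x"
abbreviation "H \<equiv> hole_pos a x"
abbreviation "w \<equiv> period a"

text \<open>Identifies \<open>w\<close> as the least number of increments by \<open>a\<close> that
  bring a standing particle to velocity 1.\<close>

lemma period_bounds: "1 \<le> real w * a" "(real w - 1) * a < 1" "2 \<le> w"
proof -
  have r: "real w = real_of_int \<lceil>1 / a\<rceil>" using a by (simp add: period_def)
  have "1 / a \<le> real w" "real w - 1 < 1 / a" unfolding r by linarith+
  then show "1 \<le> real w * a" "(real w - 1) * a < 1" using a by (simp_all add: field_simps)
  have "1 < 1 / a" using a by simp
  then have "1 < real w" using \<open>1 / a \<le> real w\<close> by linarith
  then show "2 \<le> w" by simp
qed

lemma valid_state: "valid (S t)"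
  by (induction t) (simp_all add: state_def valid_init valid_step a)

lemma state_0 [simp]: "S 0 = x"
  by (simp add: state_def)

lemma state_Suc:
  "S (Suc t) i = (if \<not> settled (S t) i then -1 else if settled (S t) (i + 1) then 0
     else min 1 ((if S t (i - 1) = 1 then 1 else S t i) + a))"
  using step_eq[OF valid_state[of t] a(1)] by (simp add: state_def)

lemma state_le_1: "S t i \<le> 1"
  and state_cases: "S t i = -1 \<or> 0 \<le> S t i"
  and state_1_next: "S t i = 1 \<Longrightarrow> S t (i + 1) = -1"
  and state_1_prev: "0 \<le> S t i \<Longrightarrow> S t (i - 1) \<noteq> 1"
  using validD[OF valid_state[of t], of i] validD(3)[OF valid_state[of t], of "i - 1"] by auto

lemma state_not_last_lt_1: "0 \<le> S t (i + 1) \<Longrightarrow> S t i < 1"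
  using state_1_next[of t i] state_le_1[of t i] by (cases "S t i = 1") auto

lemma stays:
  assumes "0 \<le> S t i" "S t i < 1"
  shows "0 \<le> S (Suc t) i"
  using assms a by (auto simp: state_Suc settled_def)

lemma accelerates:
  assumes "0 \<le> S t i" "S t i < 1" "S t (i + 1) = -1 \<or> S t (i + 1) = 1"
  shows "S (Suc t) i = min 1 (S t i + a)"
  using assms state_1_prev[of t i] by (auto simp: state_Suc settled_def)

lemma enters:
  assumes "S t (i - 1) = 1" "S t (i + 1) = -1 \<or> S t (i + 1) = 1"
  shows "S (Suc t) i = 1"
proof -
  have "S t i = -1" using state_1_next[OF assms(1)] by simp
  then show ?thesis using assms a by (auto simp: state_Suc settled_def)
qed

lemma moves_right:
  assumes "S t (i - 1) = 1"
  shows "0 \<le> S (Suc t) i"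
  using assms a by (auto simp: state_Suc settled_def)

text \<open>At time 0 a blocked particle may still carry any velocity below 1; the first
  acceleration step resets it to 0. Hence the restriction to positive times, here and in
  \<open>last_ge\<close>.\<close>

lemma not_last_zero:
  assumes "0 < t" "0 \<le> S t i" "0 \<le> S t (i + 1)"
  shows "S t i = 0"
proof -
  obtain u where "t = Suc u" using assms(1) gr0_conv_Suc by auto
  then show ?thesis using assms(2,3) by (auto simp: state_Suc[of u] split: if_splits)
qed

lemma last_ge:
  assumes "0 < t" "0 \<le> S t i" "S t (i + 1) = -1"
  shows "a \<le> S t i"
proof -
  obtain u where t: "t = Suc u" using assms(1) gr0_conv_Suc by auto
  have "settled (S u) i" "\<not> settled (S u) (i + 1)"
    using assms(2,3) a unfolding t
    by (auto simp: state_Suc[of u] settled_def split: if_splits)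
  then show ?thesis using a unfolding t
    by (auto simp: state_Suc[of u] settled_def)
qed

subsection \<open>Motion of a single hole\<close>

lemma hole_Suc: "H j (Suc t) = (if S t (H j t - 1) = 1 then H j t - 1 else H j t)"
proof -
  have "\<lfloor>S t k\<rfloor> = 1 \<longleftrightarrow> S t k = 1" for k
    using state_le_1[of t k] by (auto simp: floor_eq_iff)
  then show ?thesis by simp
qed

declare hole_pos.simps(2) [simp del]

lemma hole_antimono: "t \<le> t' \<Longrightarrow> H j t' \<le> H j t"
proof (induction rule: dec_induct)
  case (step n)
  then show ?case by (simp add: hole_Suc)
qed simp

lemma hole_le: "H j t \<le> j"
  using hole_antimono[of 0 t j] by simp

text \<open>The site vacated by a particle of velocity 1 is not refilled in the same step, because
  the site behind that particle cannot also hold velocity 1.\<close>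

lemma hole_state:
  assumes "x j = -1"
  shows "S t (H j t) = -1"
proof (induction t)
  case (Suc t)
  show ?case
  proof (cases "S t (H j t - 1) = 1")
    case True
    then show ?thesis
      using state_1_prev[of t "H j t - 1"] by (simp add: hole_Suc state_Suc settled_def)
  next
    case False
    then show ?thesis using Suc by (simp add: hole_Suc state_Suc settled_def)
  qed
qed (use assms in simp)

lemma hole_moves_between:
  "H j (t + k) < H j t \<Longrightarrow> \<exists>r. t \<le> r \<and> r < t + k \<and> H j r = H j t \<and> S r (H j r - 1) = 1"
proof (induction k)
  case (Suc k)
  show ?case
  proof (cases "H j (t + k) < H j t")
    case True
    from Suc.IH[OF this] show ?thesis by (metis add_Suc_right less_SucI)
  next
    case False
    then have e: "H j (t + k) = H j t" using hole_antimono[of t "t + k" j] by simp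
    then have "S (t + k) (H j (t + k) - 1) = 1"
      using Suc.prems by (simp add: hole_Suc split: if_splits)
    then show ?thesis using e by (intro exI[of _ "t + k"]) simp
  qed
qed simp

text \<open>As long as the hole stays, the particle behind it has free space and gains
  \<open>a\<close> per step; the disjunction keeps the induction going after the hole has
  moved.\<close>

lemma head_accelerates:
  assumes "x j = -1" "a \<le> S t (H j t - 1)"
  shows "H j (t + k) < H j t \<or>
    H j (t + k) = H j t \<and> min 1 (real (Suc k) * a) \<le> S (t + k) (H j t - 1)"
proof (induction k)
  case (Suc k)
  then consider "H j (t + k) < H j t"
    | "H j (t + k) = H j t" "min 1 (real (Suc k) * a) \<le> S (t + k) (H j t - 1)" by blast
  then show ?case
  proof cases
    case 1
    then show ?thesis using hole_antimono[of "t + k" "t + Suc k" j] by simp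
  next
    case 2
    show ?thesis
    proof (cases "S (t + k) (H j t - 1) = 1")
      case True
      then show ?thesis using 2 by (simp add: hole_Suc)
    next
      case False
      have "0 \<le> real (Suc k) * a" using a by simp
      then have "0 \<le> S (t + k) (H j t - 1)" "S (t + k) (H j t - 1) < 1"
        using 2 False state_le_1[of "t + k" "H j t - 1"] by linarith+
      then have "S (Suc (t + k)) (H j t - 1) = min 1 (S (t + k) (H j t - 1) + a)"
        by (rule accelerates) (use hole_state[OF assms(1), of "t + k"] 2 in simp)
      moreover have "min 1 (real (Suc (Suc k)) * a) \<le> min 1 (S (t + k) (H j t - 1) + a)"
        using 2(2) a by (simp add: algebra_simps min_def split: if_splits)
      ultimately show ?thesis using 2 False by (simp add: hole_Suc)
    qed
  qed
qed (use assms in simp)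

lemma head_leaves:
  assumes "x j = -1" "a \<le> S t (H j t - 1)"
  shows "H j (t + w) < H j t"
proof -
  have w: "Suc (w - 1) = w" using period_bounds(3) by simp
  from head_accelerates[OF assms, of "w - 1"]
  have "H j (t + (w - 1)) < H j t \<or> H j (t + (w - 1)) = H j t \<and> S (t + (w - 1)) (H j t - 1) = 1"
    using period_bounds(1) state_le_1[of "t + (w - 1)" "H j t - 1"] unfolding w
    by (auto simp: min_def split: if_splits)
  then have "H j (Suc (t + (w - 1))) < H j t"
    using hole_antimono[of "t + (w - 1)" "Suc (t + (w - 1))" j] by (auto simp: hole_Suc)
  then show ?thesis using w by (metis add_Suc_right)
qed

subsection \<open>Consecutive holes\<close>

definition consecutive :: "int \<Rightarrow> int \<Rightarrow> bool" where
  "consecutive g h \<longleftrightarrow> x g = -1 \<and> x h = -1 \<and> g < h \<and> (\<forall>i. g < i \<and> i < h \<longrightarrow> 0 \<le> x i)"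

text \<open>The queue of \<open>h\<close> loses only its head, which crosses \<open>h\<close>, and
  gains only the particle crossing \<open>g\<close>, which lands on the old site of
  \<open>g\<close>. So no hole is ever created between two consecutive ones, and they never
  collide.\<close>

lemma consecutive_state:
  assumes "consecutive g h"
  shows "H g t < H h t \<and> (\<forall>i. H g t < i \<and> i < H h t \<longrightarrow> 0 \<le> S t i)"
proof (induction t)
  case 0
  then show ?case using assms by (auto simp: consecutive_def)
next
  case (Suc t)
  have g: "S t (H g t) = -1" and h: "S t (H h t) = -1"
    using assms hole_state by (auto simp: consecutive_def)
  have "H g (Suc t) \<le> H g t" by (simp add: hole_Suc)
  moreover have "H g t < H h (Suc t)"
    using Suc g by (cases "H g t = H h t - 1") (auto simp: hole_Suc)
  moreover have "0 \<le> S (Suc t) i" if i: "H g (Suc t) < i" "i < H h (Suc t)" for i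
  proof (cases "H g t < i")
    case True
    then have o: "0 \<le> S t i" using Suc i by (auto simp: hole_Suc split: if_splits)
    have "S t i < 1"
    proof (cases "i = H h t - 1")
      case True
      then have "S t i \<noteq> 1" using i by (auto simp: hole_Suc)
      then show ?thesis using state_le_1[of t i] by simp
    next
      case False
      then have "0 \<le> S t (i + 1)"
        using Suc i \<open>H g t < i\<close> by (auto simp: hole_Suc split: if_splits)
      then show ?thesis by (rule state_not_last_lt_1)
    qed
    with o show ?thesis by (rule stays)
  next
    case False
    with i(1) have "S t (H g t - 1) = 1" "i = H g t" by (auto simp: hole_Suc split: if_splits)
    then show ?thesis by (intro moves_right) simp
  qed
  ultimately show ?case by auto
qed

text \<open>The leftmost hole has an infinite queue, so it never waits for an arrival.\<close>

lemma first_hole_state: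
  assumes "x h = -1" "\<And>i. i < h \<Longrightarrow> 0 \<le> x i" "i < H h t"
  shows "0 \<le> S t i"
  using assms(3)
proof (induction t arbitrary: i)
  case 0
  then show ?case using assms(2) by simp
next
  case (Suc t)
  then have i: "i < H h t" by (auto simp: hole_Suc split: if_splits)
  then have o: "0 \<le> S t i" using Suc.IH by blast
  have "S t i < 1"
  proof (cases "i = H h t - 1")
    case True
    then have "S t i \<noteq> 1" using Suc.prems by (auto simp: hole_Suc)
    then show ?thesis using state_le_1[of t i] by simp
  next
    case False
    then show ?thesis using Suc.IH[of "i + 1"] i by (intro state_not_last_lt_1) auto
  qed
  with o show ?case by (rule stays)
qed

lemma head_leaves_of_pos:
  assumes "x h = -1" "0 < t" "0 \<le> S t (H h t - 1)"
  shows "H h (t + w) < H h t"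
  using last_ge[OF assms(2,3)] hole_state[OF assms(1), of t] by (intro head_leaves assms(1)) simp

text \<open>An empty queue passes an arriving particle on without delay.\<close>

lemma passes_on:
  assumes "consecutive g h" "H h t = H g t + 1" "S t (H g t - 1) = 1"
  shows "H h (Suc (Suc t)) = H g t"
proof -
  have g: "S t (H g t) = -1" and h: "S t (H h t) = -1"
    using assms(1) hole_state by (auto simp: consecutive_def)
  have "H h (Suc t) = H g t + 1" using assms(2) g by (simp add: hole_Suc)
  moreover have "S (Suc t) (H g t) = 1" by (rule enters) (use assms h in auto)
  ultimately show ?thesis by (simp add: hole_Suc[of _ "Suc t"])
qed

text \<open>A service guarantee: \<open>C - int w * s\<close> is the deadline for reaching site
  \<open>s\<close>. In the last \<open>w\<close> steps before it, either a waiting head is served,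
  or the queue is empty and the particle released by \<open>g\<close> passes straight through. For
  the latter, \<open>g\<close> must reach \<open>s - 1\<close> one step before \<open>h\<close>
  reaches \<open>s\<close>, which is why the constant for \<open>g\<close> is
  \<open>C - int w - 1\<close>.\<close>

lemma hole_bound_step:
  fixes C :: int
  assumes h: "x h = -1" and C: "int w * h + 1 \<le> C"
    and prev: "(\<forall>i<h. 0 \<le> x i) \<or>
      (\<exists>g. consecutive g h \<and> (\<forall>t s. C - int w - 1 - int w * s \<le> int t \<longrightarrow> H g t \<le> s))"
    and t: "C - int w * s \<le> int t"
  shows "H h t \<le> s"
  using t
proof (induction "nat (h - s)" arbitrary: s t)
  case 0
  then show ?case using hole_le[of h t] by simp
next
  case (Suc n)
  then have s: "s < h" by linarith
  then have "int w * 1 \<le> int w * (h - s)" by (intro mult_left_mono) auto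
  \<comment> \<open>The \<open>+ 1\<close> in the bound on \<open>C\<close> makes
    \<open>t - w\<close> positive, so that the head at that time already has velocity at least
    \<open>a\<close>.\<close>
  then have tw: "int w + 1 \<le> int t" using Suc.prems C by (simp add: algebra_simps)
  define u where "u = t - w"
  have u: "0 < u" "t = u + w" using tw by (auto simp: u_def)
  have "H h u \<le> s + 1"
    by (rule Suc.hyps(1)) (use Suc.hyps(2) Suc.prems u in \<open>auto simp: algebra_simps\<close>)
  then consider "H h u \<le> s" | "H h u = s + 1" by linarith
  then show ?case
  proof cases
    case 1
    then show ?thesis using hole_antimono[of u t h] u by simp
  next
    case 2
    show ?thesis
    proof (cases "0 \<le> S u s")
      case True
      then have "H h (u + w) < H h u" using 2 u by (intro head_leaves_of_pos h) auto
      then show ?thesis using 2 u by simp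
    next
      case False
      have "\<not> (\<forall>i<h. 0 \<le> x i)" using first_hole_state[OF h, of s u] 2 False by auto
      then obtain g where g: "consecutive g h"
        and gb: "\<And>t s. C - int w - 1 - int w * s \<le> int t \<Longrightarrow> H g t \<le> s"
        using prev by blast
      have gs: "H g u = s"
        using consecutive_state[OF g, of u] 2 False by (smt (verit))
      \<comment> \<open>The queue of \<open>h\<close> is empty at time \<open>u\<close>. The
        deadline of \<open>g\<close> yields a particle crossing \<open>g\<close> at some
        \<open>r < t - 1\<close>, and it has crossed \<open>h\<close> by
        \<open>r + 2 <= t\<close>.\<close>
      have "H g (t - 1) \<le> s - 1"
        by (rule gb) (use Suc.prems tw in \<open>auto simp: algebra_simps\<close>)
      moreover have "t - 1 = u + (w - 1)" using u period_bounds(3) by simp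
      ultimately have "H g (u + (w - 1)) < H g u" using gs by simp
      then obtain r where r: "u \<le> r" "r < u + (w - 1)" "H g r = H g u" "S r (H g r - 1) = 1"
        using hole_moves_between by blast
      have "H g r < H h r" using consecutive_state[OF g] by blast
      then have "H h r = H g r + 1"
        using hole_antimono[OF r(1), of h] 2 gs r(3) by linarith
      then have "H h (Suc (Suc r)) = s" using passes_on[OF g] r gs by simp
      moreover have "Suc (Suc r) \<le> t" using r(2) u period_bounds(3) by simp
      ultimately show ?thesis using hole_antimono[of "Suc (Suc r)" t h] by simp
    qed
  qed
qed

end

section \<open>Propagation of periodic motion from a hole to the next one on its right\<close>

text \<open>\<open>R\<close> marks the starts of cycles of length \<open>w\<close>. Each cycle has
  its only move in its first step, so times that differ by \<open>w\<close> have the same phase, and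
  the drop by 1 extends from cycle starts to all later times.\<close>

lemma periodic_of_cycles:
  fixes f :: "nat \<Rightarrow> int"
  assumes "0 < w" "R r" "r \<le> t"
    and cycle: "\<And>t. R t \<Longrightarrow> R (t + w) \<and> (\<forall>k. 0 < k \<and> k \<le> w \<longrightarrow> f (t + k) = f t - 1)"
  shows "f (t + w) = f t - 1"
proof -
  have R: "R (r + n * w)" for n
  proof (induction n)
    case (Suc n)
    then show ?case using cycle[of "r + n * w"] by (simp add: algebra_simps)
  qed (use assms(2) in simp)
  define u k where "u = r + (t - r) div w * w" and "k = (t - r) mod w"
  have t: "t = u + k" using \<open>r \<le> t\<close> by (simp add: u_def k_def)
  have k: "k < w" using \<open>0 < w\<close> by (simp add: k_def)
  have Ru: "R u" unfolding u_def by (rule R)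
  show ?thesis
  proof (cases "k = 0")
    case True
    then show ?thesis using cycle[OF Ru] t \<open>0 < w\<close> by simp
  next
    case False
    have "f (u + w + k) = f (u + w) - 1" "f (u + w) = f u - 1" "f (u + k) = f u - 1"
      using cycle[OF Ru] cycle[of "u + w"] False k by auto
    then show ?thesis by (simp add: t algebra_simps)
  qed
qed

context traffic
begin

text \<open>The property whose least witness is \<open>transient\<close>, so every instance bounds
  the transient period.\<close>

definition periodic_from :: "int \<Rightarrow> nat \<Rightarrow> bool" where
  "periodic_from j s \<longleftrightarrow> (\<forall>t\<ge>s. H j (t + w) = H j t - 1)"

text \<open>The exact counterpart of \<open>head_accelerates\<close>: starting from velocity
  precisely \<open>a\<close>, the head needs all of the next \<open>w - 1\<close> steps to reach
  velocity 1, so the hole cannot move earlier either.\<close>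

lemma head_schedule:
  assumes "x h = -1" "S t (H h t - 1) = a" "k < w"
  shows "H h (t + k) = H h t \<and> S (t + k) (H h t - 1) = min 1 (real (Suc k) * a)"
  using assms(3)
proof (induction k)
  case 0
  then show ?case using assms(2) a by simp
next
  case (Suc k)
  then have IH: "H h (t + k) = H h t" "S (t + k) (H h t - 1) = min 1 (real (Suc k) * a)" by auto
  have "real (Suc k) * a \<le> (real w - 1) * a" using Suc.prems a by (intro mult_right_mono) auto
  then have lt: "real (Suc k) * a < 1" using period_bounds(2) by linarith
  moreover have ge: "0 \<le> real (Suc k) * a" using a by simp
  ultimately have v: "S (t + k) (H h t - 1) = real (Suc k) * a" using IH by simp
  have "S (Suc (t + k)) (H h t - 1) = min 1 (S (t + k) (H h t - 1) + a)"
    by (rule accelerates) (use v lt ge hole_state[OF assms(1), of "t + k"] IH in simp_all)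
  moreover have "H h (Suc (t + k)) = H h t" using v lt IH by (simp add: hole_Suc)
  ultimately show ?case using v by (simp add: algebra_simps)
qed

lemma head_schedule_end:
  assumes "x h = -1" "S t (H h t - 1) = a"
  shows "S (t + (w - 1)) (H h t - 1) = 1"
  using head_schedule[OF assms, of "w - 1"] period_bounds by (simp add: of_nat_diff)

text \<open>The follower begins to accelerate in the very step in which the head departs; no step is
  lost between services, so a busy hole has cycle length exactly \<open>w\<close>.\<close>

lemma next_head:
  assumes "S t (H h t - 1) = 1" "S t (H h t - 2) = 0"
  shows "S (Suc t) (H h (Suc t) - 1) = a"
proof -
  have "S (Suc t) (H h t - 2) = min 1 (S t (H h t - 2) + a)"
    by (rule accelerates) (use assms in simp_all)
  then show ?thesis using assms a by (simp add: hole_Suc)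
qed

lemma second_zero:
  assumes "consecutive g h" "0 < t" "H g t \<le> H h t - 3"
  shows "S t (H h t - 2) = 0"
  by (rule not_last_zero) (use assms consecutive_state[OF assms(1), of t] in auto)

text \<open>Cycles start at departures that leave somebody behind, the distance 3 meaning two queued
  particles. Both holes move once per cycle, so the distance is the same at the next departure and
  the situation recurs.\<close>

lemma periodic_if_queueing:
  assumes c: "consecutive g h" and s: "periodic_from g s" "s \<le> r" "0 < r"
    and r: "S r (H h r - 1) = 1" "H g r \<le> H h r - 3"
  shows "periodic_from h r"
  unfolding periodic_from_def
proof (intro allI impI)
  fix t assume "r \<le> t"
  let ?R = "\<lambda>t. r \<le> t \<and> S t (H h t - 1) = 1 \<and> H g t \<le> H h t - 3"
  have h: "x h = -1" using c by (simp add: consecutive_def)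
  show "H h (t + w) = H h t - 1"
  proof (rule periodic_of_cycles[where R = ?R and r = r])
    fix t assume R: "?R t"
    then have "S t (H h t - 2) = 0" using second_zero[OF c, of t] s by simp
    then have v: "S (Suc t) (H h (Suc t) - 1) = a" using next_head R by blast
    have H1: "H h (Suc t) = H h t - 1" using R by (simp add: hole_Suc)
    have k: "H h (t + k) = H h t - 1" if "0 < k" "k \<le> w" for k
      using head_schedule[OF h v, of "k - 1"] that H1 by simp
    have e: "Suc t + (w - 1) = t + w" using period_bounds(3) by simp
    have "H h (t + w) = H h t - 1" using k[of w] period_bounds(3) by simp
    moreover have "S (t + w) (H h (t + w) - 1) = 1"
      using head_schedule_end[OF h v] calculation H1 unfolding e by simp
    moreover have "H g (t + w) = H g t - 1"
      using s R by (auto simp: periodic_from_def)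
    ultimately show "?R (t + w) \<and> (\<forall>k. 0 < k \<and> k \<le> w \<longrightarrow> H h (t + k) = H h t - 1)"
      using R k by auto
  qed (use r \<open>r \<le> t\<close> period_bounds in auto)
qed

text \<open>The only particle in the queue leaves, and the next one finds the queue empty.\<close>

lemma singleton_queue:
  assumes c: "consecutive g h" and r: "S r (H h r - 1) = 1" "H g r = H h r - 2"
    and e: "r \<le> e" "H g e = H g r" "S e (H g e - 1) = 1"
  shows "0 < k \<Longrightarrow> r + k \<le> Suc e \<Longrightarrow> H h (r + k) = H h r - 1"
    and "S (Suc e) (H g r) = 1"
proof -
  have g: "S t (H g t) = -1" and h: "S t (H h t) = -1" for t
    using c hole_state by (auto simp: consecutive_def)
  have Hg: "H g t = H g r" if "r \<le> t" "t \<le> e" for t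
    using hole_antimono[of r t g] hole_antimono[of t e g] that e(2) by simp
  show *: "H h (r + k) = H h r - 1" if "0 < k" "r + k \<le> Suc e" for k
    using that
  proof (induction k)
    case (Suc k)
    show ?case
    proof (cases "k = 0")
      case True
      then show ?thesis using r by (simp add: hole_Suc)
    next
      case False
      then have "H h (r + k) = H g (r + k) + 1" using Suc Hg[of "r + k"] r by simp
      then have "H h (Suc (r + k)) = H h (r + k)" using g[of "r + k"] by (simp add: hole_Suc)
      then show ?thesis using Suc False by simp
    qed
  qed simp
  \<comment> \<open>The way of the particle crossing \<open>g\<close> is free: for
    \<open>e = r\<close> the old head is just departing, and later the hole \<open>h\<close> stands
    there.\<close>
  have "S e (H g r + 1) = -1 \<or> S e (H g r + 1) = 1"
  proof (cases "e = r")
    case True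
    then show ?thesis using r by simp
  next
    case False
    then have "H h e = H g r + 1" using *[of "e - r"] e r by simp
    then show ?thesis using h[of e] by simp
  qed
  then show "S (Suc e) (H g r) = 1" using e by (intro enters) auto
qed

text \<open>The condition on \<open>H g (r + (w - 1))\<close> fixes the phase: \<open>g\<close>
  moves in the last step of the cycle, so its particle arrives, still at velocity 1, exactly when
  the next departure from \<open>h\<close> is due.\<close>

lemma periodic_if_passing:
  assumes c: "consecutive g h" and s: "periodic_from g s" "s \<le> r"
    and r: "S r (H h r - 1) = 1" "H g r = H h r - 2" "H g (r + (w - 1)) = H g r"
  shows "periodic_from h r"
  unfolding periodic_from_def
proof (intro allI impI)
  fix t assume "r \<le> t"
  let ?R = "\<lambda>t. r \<le> t \<and> S t (H h t - 1) = 1 \<and> H g t = H h t - 2 \<and> H g (t + (w - 1)) = H g t"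
  show "H h (t + w) = H h t - 1"
  proof (rule periodic_of_cycles[where R = ?R and r = r])
    fix t assume R: "?R t"
    define e where "e = t + (w - 1)"
    have e: "t \<le> e" "Suc e = t + w" "H g e = H g t"
      using R period_bounds(3) by (auto simp: e_def)
    have per: "H g (u + w) = H g u - 1" if "t \<le> u" for u
      using s R that by (auto simp: periodic_from_def)
    have gw: "H g (Suc e) = H g e - 1" using per[of t] e by simp
    then have "S e (H g e - 1) = 1" by (simp add: hole_Suc split: if_splits)
    note sq = singleton_queue[OF c _ _ e(1,3) this]
    have k: "H h (t + k) = H h t - 1" if "0 < k" "k \<le> w" for k
      using sq(1)[of k] R that e by simp
    moreover have "H h (t + w) = H h t - 1" using k[of w] period_bounds(3) by simp
    moreover have "S (t + w) (H h t - 2) = 1" using sq(2) R e by simp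
    moreover have "t + w + (w - 1) = e + w" by (simp add: e_def)
    ultimately show "?R (t + w) \<and> (\<forall>k. 0 < k \<and> k \<le> w \<longrightarrow> H h (t + k) = H h t - 1)"
      using R per[of t] per[of e] e by simp
  qed (use r \<open>r \<le> t\<close> period_bounds in auto)
qed

lemma periodic_from_mono: "periodic_from j s \<Longrightarrow> s \<le> s' \<Longrightarrow> periodic_from j s'"
  by (auto simp: periodic_from_def)

text \<open>At most \<open>w\<close> steps each are spent until a particle crosses \<open>g\<close>,
  until a head leaves \<open>h\<close>, and, if that head was alone, until the next particle crosses
  \<open>g\<close>. Then one of the two recurring situations has been reached.\<close>

lemma periodic_next:
  assumes c: "consecutive g h" and s: "periodic_from g s" "0 < s"
  shows "periodic_from h (s + 3 * w)"
proof -
  have g: "S t (H g t) = -1" and h: "S t (H h t) = -1" and xh: "x h = -1" for t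
    using c hole_state by (auto simp: consecutive_def)
  have lt: "H g t < H h t" for t using consecutive_state[OF c] by blast
  have per: "H g (u + w) = H g u - 1" if "s \<le> u" for u
    using s that by (auto simp: periodic_from_def)
  obtain r where r: "s \<le> r" "r < s + w" "S r (H g r - 1) = 1"
    using hole_moves_between[of g s w] per[of s] by auto
  have "H g (Suc r) < H h (Suc r) - 1"
  proof (cases "H h r = H g r + 1")
    case True
    then show ?thesis using g[of r] r by (simp add: hole_Suc)
  next
    case False
    then show ?thesis using lt[of r] r by (auto simp: hole_Suc)
  qed
  then have "0 \<le> S (Suc r) (H h (Suc r) - 1)"
    using consecutive_state[OF c, of "Suc r"] by auto
  then obtain q where q: "Suc r \<le> q" "q < Suc r + w" "S q (H h q - 1) = 1"
    using head_leaves_of_pos[OF xh, of "Suc r"] hole_moves_between[of h "Suc r" w] by auto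
  have qs: "s \<le> q" "0 < q" "q < s + 2 * w" using q r s by auto
  have "H g q \<noteq> H h q - 1" using q g[of q] by auto
  then consider "H g q \<le> H h q - 3" | "H g q = H h q - 2" using lt[of q] by linarith
  then show ?thesis
  proof cases
    case 1
    then have "periodic_from h q" using periodic_if_queueing[OF c s(1)] qs q by blast
    then show ?thesis by (rule periodic_from_mono) (use qs in simp)
  next
    case 2
    obtain e where e: "q \<le> e" "e < q + w" "H g e = H g q" "S e (H g e - 1) = 1"
      using hole_moves_between[of g q w] per[OF qs(1)] by auto
    have g1: "H g (Suc e) = H g q - 1" using e by (simp add: hole_Suc)
    note sq = singleton_queue[OF c q(3) 2 e(1,3,4)]
    have h1: "H h (Suc e) = H h q - 1" using sq(1)[of "Suc e - q"] e by simp
    \<comment> \<open>Having just moved at \<open>e\<close>, the periodic hole \<open>g\<close>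
      stays put until \<open>e + w\<close>, which is the phase condition at
      \<open>Suc e\<close>.\<close>
    have "Suc e + (w - 1) = e + w" using period_bounds(3) by simp
    then have "H g (Suc e + (w - 1)) = H g (Suc e)" using per[of e] e qs g1 by simp
    then have "periodic_from h (Suc e)"
      using periodic_if_passing[OF c s(1), of "Suc e"] sq(2) e qs g1 h1 2 by simp
    then show ?thesis by (rule periodic_from_mono) (use qs e in simp)
  qed
qed

lemma ex_previous_hole:
  assumes "x h = -1" "x j = -1" "h < j"
  shows "\<exists>g\<ge>h. consecutive g j"
proof -
  let ?A = "{i \<in> {h..<j}. x i = -1}"
  have A: "finite ?A" by (rule finite_subset[of _ "{h..<j}"]) auto
  have hA: "h \<in> ?A" using assms by auto
  from hA have M: "Max ?A \<in> ?A" using Max_in[OF A] by blast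
  have "0 \<le> x i" if "Max ?A < i" "i < j" for i
  proof (rule ccontr)
    assume "\<not> 0 \<le> x i"
    then have "i \<in> ?A" using state_cases[of 0 i] that M by auto
    then show False using Max_ge[OF A] that by fastforce
  qed
  then show ?thesis using M assms unfolding consecutive_def by (intro exI[of _ "Max ?A"]) auto
qed

text \<open>Each hole on the way costs \<open>3 * w\<close> steps, and the distance bounds the
  number of holes.\<close>

lemma periodic_right:
  assumes h: "x h = -1" "periodic_from h s" "0 < s"
    and j: "x j = -1" "h \<le> j"
  shows "periodic_from j (s + 3 * w * nat (j - h))"
  using j
proof (induction "nat (j - h)" arbitrary: j rule: less_induct)
  case less
  show ?case
  proof (cases "h = j")
    case True
    then show ?thesis using h by simp
  next
    case False
    then obtain g where g: "h \<le> g" "consecutive g j"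
      using ex_previous_hole[OF h(1) less.prems(1)] less.prems(2) by auto
    then have gj: "g < j" "x g = -1" by (auto simp: consecutive_def)
    have "periodic_from g (s + 3 * w * nat (g - h))"
      by (rule less.hyps) (use g gj in auto)
    then have p: "periodic_from j (s + 3 * w * nat (g - h) + 3 * w)"
      using periodic_next[OF g(2)] h(3) by simp
    have "3 * w * Suc (nat (g - h)) \<le> 3 * w * nat (j - h)"
      using g gj by (intro mult_le_mono2) simp
    then show ?thesis by (intro periodic_from_mono[OF p]) simp
  qed
qed

subsection \<open>Jams that are never exhausted\<close>

text \<open>By time \<open>n * w\<close> the hole \<open>g\<close> has reached
  \<open>h - n - 4\<close>, while \<open>h\<close> with a nonempty queue is still at
  \<open>h - n\<close> or to its right, except for a move due only at the next cycle. Arrivals thus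
  keep ahead of departures, so the service at \<open>h\<close> is never interrupted and is periodic
  from time 1.\<close>

lemma lasting_jam:
  fixes C :: int
  assumes c: "consecutive g h" and x0: "x (h - 1) = 0"
    and gb: "\<And>t s. C - int w * s \<le> int t \<Longrightarrow> H g t \<le> s"
    and C: "C + 4 * int w \<le> int w * h" and gap: "g \<le> h - 4"
  shows "H g t \<le> H h t - 4" and "periodic_from h 1"
proof -
  have xh: "x h = -1" using c by (simp add: consecutive_def)
  have gb': "H g t \<le> h - int n - 4" if "n * w \<le> t" for n t
  proof (rule gb)
    have "int n * int w \<le> int t" using that by (metis of_nat_le_iff of_nat_mult)
    then show "C - int w * (h - int n - 4) \<le> int t" using C by (simp add: algebra_simps)
  qed
  \<comment> \<open>The offset 1 is the first step, in which the head, initially at velocity 0, gets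
    velocity \<open>a\<close>; each later service starts \<open>w\<close> steps after the previous
    one.\<close>
  have cyc: "H h (Suc (n * w)) = h - int n \<and> S (Suc (n * w)) (h - int n - 1) = a" for n
  proof (induction n)
    case 0
    have "S (Suc 0) (h - 1) = min 1 (S 0 (h - 1) + a)"
      by (rule accelerates) (use x0 xh in simp_all)
    then show ?case using x0 a by (simp add: hole_Suc)
  next
    case (Suc n)
    let ?t = "Suc (n * w)"
    define u where "u = ?t + (w - 1)"
    have v: "S ?t (H h ?t - 1) = a" using Suc by simp
    have u: "H h u = h - int n" unfolding u_def using head_schedule[OF xh v, of "w - 1"] Suc period_bounds(3) by simp
    moreover have "S u (H h u - 1) = 1" using head_schedule_end[OF xh v] Suc u by (simp add: u_def)
    moreover have "S u (H h u - 2) = 0"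
      using gb'[of n u] u by (intro second_zero[OF c]) (auto simp: u_def)
    ultimately have "H h (Suc u) = h - int (Suc n)" "S (Suc u) (h - int (Suc n) - 1) = a"
      using next_head[of u h] by (auto simp: hole_Suc[of h u])
    moreover have "Suc u = Suc (Suc n * w)" using period_bounds(3) by (simp add: u_def)
    ultimately show ?case by simp
  qed
  have Hh: "H h (Suc (n * w) + k) = h - int n" if "k < w" for n k
    using head_schedule[OF xh _ that, of "Suc (n * w)"] cyc[of n] by simp
  have w: "0 < w" using period_bounds(3) by simp
  have Ht: "H h (Suc t) = h - int (t div w)" for t
    using Hh[of "t mod w" "t div w"] w by simp
  show "H g t \<le> H h t - 4"
  proof (cases t)
    case 0
    then show ?thesis using gap by simp
  next
    case (Suc u)
    show ?thesis using gb'[of "u div w" t] Ht[of u] Suc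
      by (simp add: div_times_less_eq_dividend le_SucI)
  qed
  show "periodic_from h 1"
    unfolding periodic_from_def
  proof (intro allI impI)
    fix t :: nat assume "1 \<le> t"
    then obtain u where "t = Suc u" by (cases t) auto
    then show "H h (t + w) = H h t - 1" using Ht[of u] Ht[of "u + w"] w by simp
  qed
qed

lemma particle_Suc_of_occupied:
  assumes "0 \<le> S t (particle_pos a x j t)"
  shows "particle_pos a x j (Suc t) =
    particle_pos a x j t + (if S t (particle_pos a x j t) = 1 then 1 else 0)"
  using assms state_le_1[of t "particle_pos a x j t"] by (auto simp: floor_eq_iff)

lemma particle_state:
  assumes "0 \<le> x j"
  shows "0 \<le> S t (particle_pos a x j t)"
proof (induction t)
  case (Suc t)
  let ?p = "particle_pos a x j t"
  show ?case
  proof (cases "S t ?p = 1")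
    case True
    then show ?thesis using moves_right[of t "?p + 1"] particle_Suc_of_occupied[OF Suc] by simp
  next
    case False
    then have "S t ?p < 1" using state_le_1[of t ?p] by simp
    then show ?thesis using stays[OF Suc] particle_Suc_of_occupied[OF Suc] False by simp
  qed
qed (use assms in simp)

lemmas particle_Suc = particle_Suc_of_occupied[OF particle_state]

text \<open>The jam keeps the whole queue except a head of velocity 1, which is already free. A gap
  of 4 means at least three queued particles, enough for a common site of the queue at successive
  times, so \<open>jam_at\<close> follows it.\<close>

lemma jam_at_lasting:
  assumes c: "consecutive g h" and x0: "x (h - 1) \<noteq> 1" and gap: "\<And>t. H g t \<le> H h t - 4"
  shows "{H g t + 1..(if S t (H h t - 1) = 1 then H h t - 2 else H h t - 1)}
    \<subseteq> jam_at a x (g + 1) (h - 1) t"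
proof (induction t)
  case 0
  then show ?case using x0 by simp
next
  case (Suc t)
  define J where "J t = {H g t + 1..(if S t (H h t - 1) = 1 then H h t - 2 else H h t - 1)}" for t
  have g: "S t (H g t) = -1" and h: "S t (H h t) = -1" for t
    using c hole_state by (auto simp: consecutive_def)
  have occ: "0 \<le> S t i" if "H g t < i" "i < H h t" for i t
    using consecutive_state[OF c] that by blast
  have lt: "S t i < 1" if "i \<in> J t" for i t
  proof (cases "i = H h t - 1")
    case True
    then show ?thesis using that state_le_1[of t i] unfolding J_def by (auto split: if_splits)
  next
    case False
    then show ?thesis
      using that occ[of t "i + 1"] by (intro state_not_last_lt_1) (auto simp: J_def split: if_splits)
  qed
  let ?lo = "H g (Suc t) + 1"
  let ?hi = "if S (Suc t) (H h (Suc t) - 1) = 1 then H h (Suc t) - 2 else H h (Suc t) - 1"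
  have "is_jam (S (Suc t)) ?lo ?hi"
    unfolding is_jam_def
  proof (intro conjI ballI)
    show "?lo \<le> ?hi" using gap[of "Suc t"] by auto
    show "S (Suc t) (?lo - 1) < 0" using g[of "Suc t"] by simp
    show "1 \<le> \<bar>S (Suc t) (?hi + 1)\<bar>" using h[of "Suc t"] by auto
    fix i assume i: "i \<in> {?lo..?hi}"
    then show "0 \<le> S (Suc t) i" using occ[of "Suc t" i] by (auto split: if_splits)
    show "S (Suc t) i < 1" using lt[of i "Suc t"] i by (simp add: J_def)
  qed
  moreover have "{?lo..?hi} \<inter> jam_at a x (g + 1) (h - 1) t \<noteq> {}"
  proof -
    \<comment> \<open>The particle on this site is not the head at time \<open>Suc t\<close>, and it
      has velocity below 1 both before and after the step.\<close>
    have "H h (Suc t) - 2 \<in> J t" using gap[of t] by (auto simp: J_def hole_Suc)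
    moreover have "H h (Suc t) - 2 \<in> J (Suc t)" using gap[of "Suc t"] by (auto simp: J_def)
    moreover have "J t \<subseteq> jam_at a x (g + 1) (h - 1) t" using Suc unfolding J_def .
    ultimately show ?thesis unfolding J_def by blast
  qed
  ultimately show ?case by (simp only: jam_at.simps) blast
qed

text \<open>Particles never move left, so once \<open>g\<close> has come down to \<open>j\<close>
  the two must have crossed. Crossing is an exchange of adjacent sites, after which the particle is
  the rearmost one of the jam.\<close>

lemma joins_lasting_jam:
  assumes c: "consecutive g h" and x0: "x (h - 1) \<noteq> 1" and gap: "\<And>t. H g t \<le> H h t - 4"
    and j: "j < g" "0 \<le> x j" and t: "H g T \<le> j"
  shows "joins a x (g + 1) (h - 1) j"
proof -
  let ?p = "particle_pos a x j"
  have xg: "x g = -1" using c by (simp add: consecutive_def)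
  have "j \<le> ?p t" for t
    by (induction t) (use j particle_Suc in auto)
  then have "H g T \<le> ?p T" using t by (meson order_trans)
  moreover have ne: "?p t \<noteq> H g t" for t
    using particle_state[OF j(2), of t] hole_state[OF xg, of t] by auto
  ultimately have T: "H g T < ?p T" by (metis order_le_imp_less_or_eq)
  define n where "n = (LEAST t. H g t < ?p t)"
  have n: "H g n < ?p n" unfolding n_def by (rule LeastI[where P = "\<lambda>t. H g t < ?p t", OF T])
  have "n \<noteq> 0" using n j by (intro notI) simp
  then obtain m where m: "n = Suc m" by (cases n) auto
  have "\<not> H g m < ?p m" using not_less_Least[of m "\<lambda>t. H g t < ?p t"] m by (simp add: n_def)
  then have "?p m < H g m" using ne[of m] by simp
  then have "?p n = H g n + 1"
    using n particle_Suc[OF j(2), of m] unfolding m by (auto simp: hole_Suc split: if_splits)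
  then have "?p n \<in> jam_at a x (g + 1) (h - 1) n"
    using jam_at_lasting[OF c x0 gap, of n] gap[of n] by (auto split: if_splits)
  then show ?thesis using \<open>n \<noteq> 0\<close> unfolding joins_def by blast
qed

end

section \<open>The delay of holes\<close>

text \<open>Lindley's recursion for the delay, in excess of \<open>w\<close> per site, with which holes are served.\<close>

primrec congestion :: "nat \<Rightarrow> config \<Rightarrow> nat \<Rightarrow> int" where
  "congestion w x 0 = 1"
| "congestion w x (Suc n) =
     max 1 (congestion w x n + (if x (int (Suc n)) = -1 then 1 else - int w))"

lemma congestion_ge_1: "1 \<le> congestion w x n"
  by (cases n) auto

lemma congestion_decrease: "congestion w x m - int w * int n \<le> congestion w x (m + n)"
proof (induction n)
  case (Suc n)
  have "congestion w x (m + n) - int w \<le> congestion w x (Suc (m + n))" by (auto simp: max_def)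
  then show ?case using Suc by (simp add: algebra_simps del: congestion.simps)
qed simp

text \<open>Either the recursion is reset to 1 within the window and afterwards grows only at holes,
  or it is never reset and all increments add up.\<close>

lemma congestion_le:
  fixes x :: config
  defines "N m n \<equiv> int (card {i \<in> {int m<..int (m + n)}. x i = -1})"
  shows "congestion w x (m + n)
    \<le> max (1 + N m n) (congestion w x m + N m n - int w * (int n - N m n))"
proof (induction n)
  case 0
  then show ?case by (simp add: N_def)
next
  case (Suc n)
  let ?A = "\<lambda>n. {i \<in> {int m<..int (m + n)}. x i = -1}"
  have fin: "finite (?A n)" by (rule finite_subset[of _ "{int m<..int (m + n)}"]) auto
  have "{int m<..int (m + Suc n)} = insert (int (Suc (m + n))) {int m<..int (m + n)}" by auto
  then have "?A (Suc n) = (if x (int (Suc (m + n))) = -1 then insert (int (Suc (m + n))) (?A n) else ?A n)"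
    by auto
  then have N: "N m (Suc n) = N m n + (if x (int (Suc (m + n))) = -1 then 1 else 0)"
    using fin by (auto simp: N_def)
  have "0 \<le> N m n" by (simp add: N_def)
  then show ?case using Suc N by (auto simp: algebra_simps max_def split: if_splits)
qed

lemma (in traffic) hole_bound:
  assumes left: "\<And>i. i \<le> 0 \<Longrightarrow> 0 \<le> x i" and h: "x h = -1"
    and t: "int w * h + congestion w x (nat h) - int w * s \<le> int t"
  shows "H h t \<le> s"
  using h t
proof (induction "nat h" arbitrary: h s t rule: less_induct)
  case less
  let ?C = "int w * h + congestion w x (nat h)"
  have "(\<forall>i<h. 0 \<le> x i) \<or>
      (\<exists>g. consecutive g h \<and> (\<forall>t s. ?C - int w - 1 - int w * s \<le> int t \<longrightarrow> H g t \<le> s))"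
  proof (rule disjCI)
    assume "\<not> (\<exists>g. consecutive g h \<and> (\<forall>t s. ?C - int w - 1 - int w * s \<le> int t \<longrightarrow> H g t \<le> s))"
      (is "\<not> ?E")
    show "\<forall>i<h. 0 \<le> x i"
    proof (rule ccontr)
      assume "\<not> (\<forall>i<h. 0 \<le> x i)"
      then obtain i where i: "i < h" "x i = -1" using state_cases[of 0] by auto
      then obtain g where c: "consecutive g h" using ex_previous_hole less.prems(1) by blast
      then have g: "x g = -1" "g < h" by (auto simp: consecutive_def)
      have pos: "0 < g" using left[of g] g by force
      \<comment> \<open>The number of particles queued between the two holes; each lowers
        \<open>congestion\<close> by at most \<open>w\<close>, which matches the constant demanded
        by \<open>hole_bound_step\<close>.\<close>
      define n where "n = nat (h - g - 1)"
      have n: "nat h = Suc (nat g + n)" "int n = h - g - 1" using pos g by (auto simp: n_def)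
      have "int (Suc (nat g + n)) = h" using n pos by linarith
      then have "congestion w x (nat h) \<ge> congestion w x (nat g + n) + 1"
        using less.prems(1) n by simp
      then have G: "congestion w x (nat h) \<ge> congestion w x (nat g) - int w * (h - g - 1) + 1"
        using congestion_decrease[of w x "nat g" n] n by simp
      have "H g t \<le> s" if "?C - int w - 1 - int w * s \<le> int t" for t s
        by (rule less.hyps) (use G that g pos in \<open>auto simp: algebra_simps\<close>)
      then have ?E using c by blast
      then show False using \<open>\<not> ?E\<close> by blast
    qed
  qed
  then show ?case
    by (intro hole_bound_step[OF less.prems(1) _ _ less.prems(2)])
      (use congestion_ge_1[of w x "nat h"] in auto)
qed

section \<open>Perturbations of a periodic configuration\<close>

text \<open>Independent of \<open>a\<close>: its density 20/41 is below 1/2 and above 1/3, the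
  largest possible value of \<gamma>1.\<close>

definition blocks :: config where
  "blocks i = (if i mod 41 < 20 then 0 else -1)"

lemma mod_41:
  fixes i q :: int
  assumes "41 * q \<le> i" "i \<le> 41 * q + 40"
  shows "i mod 41 = i - 41 * q"
proof -
  have "i = (i - 41 * q) + 41 * q" by simp
  then have "i mod 41 = (i - 41 * q) mod 41" by (metis mod_mult_self2)
  then show ?thesis using assms by simp
qed

lemma valid_blocks: "valid blocks"
  by (simp add: valid_def blocks_def)

text \<open>Counting starts at site 1, so the particle with residue 0 is the last one of its period,
  and a partial period contributes at most 19.\<close>

lemma card_blocks:
  "card {i \<in> {1..int n}. occupied blocks i} = 20 * (n div 41) + min (n mod 41) 19"
proof (induction n)
  case 0
  then show ?case by simp
next
  case (Suc n)
  let ?A = "\<lambda>n. {i \<in> {1..int n}. occupied blocks i}"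
  have occ: "occupied blocks (int k) \<longleftrightarrow> k mod 41 < 20" for k
    using zmod_int[of k 41] by (simp add: occupied_def blocks_def)
  have fin: "finite (?A n)" by (rule finite_subset[of _ "{1..int n}"]) auto
  have "{1..int (Suc n)} = insert (int (Suc n)) {1..int n}" by auto
  then have "?A (Suc n) = (if occupied blocks (int (Suc n)) then insert (int (Suc n)) (?A n) else ?A n)"
    by auto
  then have "card (?A (Suc n)) = card (?A n) + (if Suc n mod 41 < 20 then 1 else 0)"
    using fin by (simp add: occ[of "Suc n"] del: of_nat_Suc)
  moreover have "20 * (Suc n div 41) + min (Suc n mod 41) 19 =
    20 * (n div 41) + min (n mod 41) 19 + (if Suc n mod 41 < 20 then 1 else 0)"
    by (cases "n mod 41 = 40") (simp_all add: div_Suc mod_Suc min_def)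
  ultimately show ?case using Suc by linarith
qed

lemma density_blocks: "has_density blocks (20 / 41)"
proof -
  define c where "c n = card {i \<in> {1..int n}. occupied blocks i}" for n
  have "\<bar>seg_density blocks 1 (int n) - 20 / 41\<bar> \<le> 20 * inverse (real n)" if "0 < n" for n
  proof -
    have "c n = 20 * (n div 41) + min (n mod 41) 19" unfolding c_def by (rule card_blocks)
    then have "41 * c n \<le> 20 * n + 820" "20 * n \<le> 41 * c n + 820" using div_mult_mod_eq[of n 41] by (simp_all add: min_def split: if_splits)
    then have "\<bar>real (c n) - 20 / 41 * real n\<bar> \<le> 20"
      by (simp add: abs_le_iff field_simps)
    moreover have "seg_density blocks 1 (int n) - 20 / 41 = (real (c n) - 20 / 41 * real n) / real n"
      using that by (simp add: seg_density_def c_def field_simps)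
    moreover have "\<bar>(real (c n) - 20 / 41 * real n) / real n\<bar> =
        \<bar>real (c n) - 20 / 41 * real n\<bar> * inverse (real n)"
      by (simp only: divide_inverse abs_mult) simp
    ultimately show ?thesis by (simp only: mult_right_mono inverse_nonnegative_iff_nonnegative of_nat_0_le_iff)
  qed
  then have "\<forall>\<^sub>F n in sequentially.
      norm (seg_density blocks 1 (int n) - 20 / 41) \<le> 20 * inverse (real n)"
    by (intro eventually_mono[OF eventually_gt_at_top[of 0]]) simp
  then have "(\<lambda>n. seg_density blocks 1 (int n) - 20 / 41) \<longlonglongrightarrow> 0"
    by (rule Lim_null_comparison) (rule tendsto_mult_right_zero[OF lim_inverse_n])
  then show ?thesis unfolding has_density_def by (simp add: LIM_zero_iff)
qed

section \<open>Configurations with at most one changed site in any two successive periods\<close>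

locale perturbed =
  fixes a :: real and y :: config
  assumes a: "0 < a" "a < 1" and y: "y \<in> admissible"
    and close: "\<And>n. card {i \<in> {n..<n + 82}. y i \<noteq> blocks i} \<le> 1"
begin

abbreviation "z \<equiv> normalized y"

lemma valid_y: "valid y"
  using y by (rule admissible_imp_valid)

lemma valid_z: "valid z"
  using valid_y by (simp add: valid_def normalized_def)

sublocale traffic a z
  by unfold_locales (use a valid_z in auto)

lemma differ_once:
  assumes "n \<le> i" "i < n + 82" "n \<le> j" "j < n + 82" "y i \<noteq> blocks i" "y j \<noteq> blocks j"
  shows "i = j"
proof (rule ccontr)
  assume "i \<noteq> j"
  let ?D = "{i \<in> {n..<n + 82}. y i \<noteq> blocks i}"
  have "finite ?D" by (rule finite_subset[of _ "{n..<n + 82}"]) auto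
  then have "card {i, j} \<le> card ?D" by (rule card_mono) (use assms in auto)
  then show False using close[of n] \<open>i \<noteq> j\<close> by simp
qed

text \<open>The range takes in the two holes bounding the cluster, so that they are consecutive
  holes in the perturbed configuration as well.\<close>

definition clean :: "int \<Rightarrow> bool" where
  "clean q \<longleftrightarrow> (\<forall>i. 41 * q - 1 \<le> i \<and> i \<le> 41 * q + 20 \<longrightarrow> y i = blocks i)"

text \<open>The two stretches are disjoint and fit into a window of 82 sites, which has room for
  only one change.\<close>

lemma clean_or_next: "clean r \<or> clean (r + 1)"
proof (rule ccontr)
  assume "\<not> ?thesis"
  then obtain i j where "41 * r - 1 \<le> i" "i \<le> 41 * r + 20" "y i \<noteq> blocks i"
    "41 * r + 40 \<le> j" "j \<le> 41 * r + 61" "y j \<noteq> blocks j"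
    by (auto simp: clean_def algebra_simps)
  then show False using differ_once[of "41 * r - 1" i j] by auto
qed

lemma card_holes:
  assumes "0 < n" "n \<le> m" "m = 41 * q + 40" "41 * q \<le> n"
  shows "card {i \<in> {n..m}. z i = -1} \<le> 22"
proof -
  let ?D = "{i \<in> {n..<n + 82}. y i \<noteq> blocks i}"
  have fin: "finite ?D" by (rule finite_subset[of _ "{n..<n + 82}"]) auto
  have "{i \<in> {n..m}. z i = -1} \<subseteq> {41 * q + 20..41 * q + 40} \<union> ?D"
    using assms mod_41[of q] by (auto simp: normalized_def blocks_def split: if_splits)
  then have "card {i \<in> {n..m}. z i = -1} \<le> card ({41 * q + 20..41 * q + 40} \<union> ?D)"
    using fin by (intro card_mono) auto
  also have "\<dots> \<le> card {41 * q + 20..41 * q + 40} + card ?D" by (rule card_Un_le)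
  also have "\<dots> \<le> 22" using close[of n] by simp
  finally show ?thesis .
qed

text \<open>A period has at most 22 holes and hence at least 19 particles. As \<open>w >= 2\<close>,
  its net effect is at most 22 - 38 < 0, so only the growth after a reset, 1 + 22, remains. The site
  considered is the last one before a cluster.\<close>

lemma congestion_bound: "congestion w z (41 * q + 40) \<le> 23"
proof (induction q)
  case 0
  define N where "N = card {i \<in> {int 0<..int (0 + 40)}. z i = -1}"
  have "{int 0<..int (0 + 40)} = {1..41 * 0 + 40}" by auto
  then have "N \<le> 22" unfolding N_def using card_holes[of 1 40 0] by simp
  moreover have "0 \<le> int w * (40 - int N)" using \<open>N \<le> 22\<close> by simp
  ultimately show ?case using congestion_le[of w z 0 40] unfolding N_def[symmetric] by simp
next
  case (Suc q)
  define m where "m = 41 * q + 40"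
  define N where "N = card {i \<in> {int m<..int (m + 41)}. z i = -1}"
  have "{int m<..int (m + 41)} = {41 * int (Suc q)..41 * int (Suc q) + 40}" by (auto simp: m_def)
  then have N: "N \<le> 22" unfolding N_def using card_holes[of "41 * int (Suc q)" _ "int (Suc q)"] by simp
  have "2 * 19 \<le> int w * (41 - int N)" using N period_bounds(3) by (intro mult_mono) auto
  then have "congestion w z (m + 41) \<le> 23"
    using congestion_le[of w z m 41] Suc N unfolding N_def[symmetric] m_def[symmetric] by simp
  moreover have "41 * Suc q + 40 = m + 41" by (simp add: m_def)
  ultimately show ?case by metis
qed

context
  fixes q :: int
  assumes q: "0 < q" "clean q"
begin

abbreviation (input) "g \<equiv> 41 * q - 1"
abbreviation (input) "h \<equiv> 41 * q + 20"

lemma z_clean: "g \<le> i \<Longrightarrow> i \<le> h \<Longrightarrow> z i = (if i = g \<or> i = h then -1 else 0)"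
proof -
  assume i: "g \<le> i" "i \<le> h"
  then have "z i = blocks i" using q by (simp add: clean_def normalized_def)
  moreover have "i mod 41 < 20 \<longleftrightarrow> \<not> (i = g \<or> i = h)"
    using i mod_41[of q i] mod_41[of "q - 1" i] by (cases "i = g") auto
  ultimately show ?thesis by (simp add: blocks_def)
qed

lemma consecutive_clean: "consecutive g h"
  by (simp add: consecutive_def z_clean)

lemma hole_bound_clean:
  assumes "int w * g + 23 - int w * s \<le> int t"
  shows "H g t \<le> s"
proof (rule hole_bound)
  have "nat g = 41 * nat (q - 1) + 40" using q by simp
  then have "congestion w z (nat g) \<le> 23" using congestion_bound[of "nat (q - 1)"] by simp
  then show "int w * g + congestion w z (nat g) - int w * s \<le> int t" using assms by simp
  show "z g = -1" by (simp add: z_clean)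
qed (simp add: normalized_def)

lemma lasting_clean: "H g t \<le> H h t - 4" "periodic_from h 1"
proof -
  \<comment> \<open>As \<open>h - g = 21\<close>, this amounts to \<open>23 <= 17 * w\<close>: the
    cluster outlasts the worst delay of its input.\<close>
  have "int w * g + 23 + 4 * int w \<le> int w * h"
    using period_bounds(3) by (simp add: algebra_simps)
  note * = lasting_jam[OF consecutive_clean _ hole_bound_clean this]
  show "H g t \<le> H h t - 4" "periodic_from h 1"
    by (rule *; simp add: z_clean)+
qed

lemma jam_clean: "is_jam z (41 * q) (41 * q + 19)"
  by (auto simp: is_jam_def z_clean)

text \<open>Normalization fills all nonpositive sites, and \<open>g\<close> eventually passes each
  of them, so every one of these particles joins.\<close>

lemma basin_clean: "infinite (basin a z (41 * q) (41 * q + 19))"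
proof -
  have joins: "joins a z n m j" if "j \<le> 0" "n = g + 1" "m = h - 1" for n m j
    unfolding that(2,3)
  proof (rule joins_lasting_jam[OF consecutive_clean])
    show "H g (nat (int w * g + 23 - int w * j)) \<le> j" by (rule hole_bound_clean) simp
  qed (use that q z_clean lasting_clean in \<open>auto simp: normalized_def\<close>)
  have "joins a z (41 * q) (41 * q + 19) j" if "j \<le> 0" for j
    by (rule joins) (use that in auto)
  then have "{..0} \<subseteq> basin a z (41 * q) (41 * q + 19)"
    using q by (auto simp: basin_def occupied_def normalized_def)
  then show ?thesis using infinite_Iic finite_subset by blast
qed

end

lemma ex_clean_between: "\<exists>q. r \<le> q \<and> q \<le> r + 1 \<and> clean q"
  using clean_or_next[of r] by (metis le_add_same_cancel1 order_refl zero_le_one)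

lemma ultimately_jammed: "ultimately_jammed a y"
  unfolding ultimately_jammed_def
proof (intro conjI bexI[of _ z] allI)
  show "z \<in> admissible"
    by (rule valid_imp_admissible[OF valid_z, of 0]) (simp add: occupied_def normalized_def)
  show "equivalent y z" by (auto simp: equivalent_def normalized_def intro!: exI[of _ 1])
  fix k
  obtain q where "max 1 (k + 1) \<le> q" "clean q" using ex_clean_between by blast
  then show "\<exists>n m. k < n \<and> is_jam z n m \<and> infinite (basin a z n m)"
    using jam_clean[of q] basin_clean[of q] by (intro exI[of _ "41 * q"] exI[of _ "41 * q + 19"]) auto
qed (rule y)

text \<open>One of the two clusters with indices \<open>j div 41 - 2\<close> and
  \<open>j div 41 - 1\<close> is clean, and its index is positive as \<open>123 = 3 * 41\<close>.
  Its leading hole is at distance at most 40 + 82 - 20 = 102 from \<open>j\<close>.\<close>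

lemma periodic_uniformly:
  assumes "123 \<le> j" "z j = -1"
  shows "periodic_from j (1 + 3 * w * 102)"
proof -
  obtain q where q: "j div 41 - 2 \<le> q" "q \<le> j div 41 - 1" "clean q"
    using ex_clean_between[of "j div 41 - 2"] by auto
  have "3 \<le> j div 41" using assms by linarith
  then have q0: "0 < q" using q by simp
  have d: "41 * q + 20 \<le> j" "j - (41 * q + 20) \<le> 102" using q by linarith+
  have "periodic_from j (1 + 3 * w * nat (j - (41 * q + 20)))"
    by (rule periodic_right[OF _ lasting_clean(2)[OF q0 q(3)]])
      (use z_clean[OF q0 q(3), of "41 * q + 20"] assms d in auto)
  then show ?thesis
    by (rule periodic_from_mono) (use d in \<open>intro add_left_mono mult_le_mono2, simp\<close>)
qed

text \<open>Both terms of the defect lie between 0 and the transient period, so its uniform bound is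
  inherited.\<close>

lemma defect_bound:
  assumes "123 \<le> j" "z j = -1"
  shows "\<bar>defect a z j\<bar> \<le> real (1 + 3 * w * 102)"
proof -
  let ?T = "transient a z j"
  have "?T \<le> 1 + 3 * w * 102"
    unfolding transient_def
    by (rule Least_le) (use periodic_uniformly[OF assms] in \<open>simp add: periodic_from_def\<close>)
  moreover have "met_particles a z j \<le> ?T"
  proof -
    have "met_particles a z j \<le> card {..<?T}"
      unfolding met_particles_def by (intro card_mono) auto
    then show ?thesis by simp
  qed
  moreover have "real ?T / real w \<le> real ?T / 1"
    using period_bounds(3) by (intro divide_left_mono) auto
  moreover have "0 \<le> real ?T / real w" by simp
  ultimately show ?thesis unfolding defect_def by linarith
qed

lemma Reg_eq_0: "Reg a y = 0"
proof -
  let ?A = "{j. 0 \<le> j \<and> \<not> occupied z j}"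
  let ?F = "inf at_top (principal ?A)"
  let ?K = "real (1 + 3 * w * 102)"
  \<comment> \<open>A \<open>Limsup\<close> along the trivial filter would not be 0; the holes in
    front of clean clusters provide arbitrarily large positions.\<close>
  have "?F \<noteq> bot"
  proof
    assume "?F = bot"
    then have "eventually (\<lambda>j. False) ?F" by simp
    then obtain N where N: "\<And>j. N \<le> j \<Longrightarrow> j \<notin> ?A"
      unfolding eventually_inf_principal eventually_at_top_linorder by auto
    obtain q where q: "max 1 N \<le> q" "clean q" using ex_clean_between by blast
    then have "41 * q + 20 \<in> ?A"
      using z_clean[of q "41 * q + 20"] by (simp add: occupied_def)
    then show False using N[of "41 * q + 20"] q by auto
  qed
  have hole: "z j = -1" if "j \<in> ?A" for j
    using that validD(1)[OF valid_z, of j] by (auto simp: occupied_def)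
  have "filterlim real_of_int at_top at_top"
    by (rule filterlim_real_of_int_at_top)
  then have "((\<lambda>j. ?K / real_of_int j) \<longlongrightarrow> 0) at_top"
    by (intro tendsto_divide_0[OF tendsto_const] filterlim_at_top_imp_at_infinity)
  then have lim: "((\<lambda>j. ?K / real_of_int j) \<longlongrightarrow> 0) ?F"
    by (rule tendsto_mono[OF inf_le1])
  have "\<forall>\<^sub>F j in ?F. norm (\<bar>defect a z j\<bar> / real_of_int j) \<le> ?K / real_of_int j"
    unfolding eventually_inf_principal
    using eventually_ge_at_top[of 123]
  proof (rule eventually_mono, intro impI)
    fix j :: int assume "123 \<le> j" "j \<in> ?A"
    then show "norm (\<bar>defect a z j\<bar> / real_of_int j) \<le> ?K / real_of_int j"
      using defect_bound[OF _ hole] by (simp add: divide_right_mono)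
  qed
  then have "((\<lambda>j. \<bar>defect a z j\<bar> / real_of_int j) \<longlongrightarrow> 0) ?F"
    using lim by (rule Lim_null_comparison)
  then have "((\<lambda>j. ereal (\<bar>defect a z j\<bar> / real_of_int j)) \<longlongrightarrow> 0) ?F"
    by (simp add: zero_ereal_def)
  then show ?thesis unfolding Reg_def by (rule lim_imp_Limsup[OF \<open>?F \<noteq> bot\<close>])
qed

lemma regular: "regular a y"
  unfolding regular_def using ultimately_jammed Reg_eq_0 by blast

end

theorem theorem4p2:
  fixes a \<gamma>1 \<gamma>2 :: real and w :: nat
  assumes "0 < a" and "a < 1"
    and "w = nat \<lceil>1 / a\<rceil>"
    and "\<gamma>1 = 1 / (1 + real w)"
    and "\<gamma>2 = 1 / 2"
  shows "\<exists>x\<in>admissible. \<exists>\<rho>. regular a x \<and> has_density x \<rho> \<and> \<gamma>1 < \<rho> \<and> \<rho> < \<gamma>2 \<and>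
           (\<exists>A B :: nat. 0 < A \<and> A < B \<and>
              (\<forall>y\<in>admissible.
                 (\<forall>n :: int. card {i \<in> {n..<n + int B}. y i \<noteq> x i} \<le> A) \<longrightarrow> regular a y))"
proof -
  have adm: "blocks \<in> admissible"
    by (rule valid_imp_admissible[OF valid_blocks, of 0]) (simp add: occupied_def blocks_def)
  have reg: "regular a y"
    if "y \<in> admissible" "\<And>n. card {i \<in> {n..<n + 82}. y i \<noteq> blocks i} \<le> 1" for y
  proof -
    interpret perturbed a y by unfold_locales (use assms that in auto)
    show ?thesis by (rule regular)
  qed
  have "2 \<le> w"
    using traffic.period_bounds(3)[of a blocks] assms valid_blocks
    by (simp add: traffic_def period_def)
  \<comment> \<open>This uses \<open>w >= 2\<close>, which comes from \<open>a < 1\<close>.\<close>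
  then have "\<gamma>1 \<le> 1 / 3" unfolding assms(4) by (intro divide_left_mono) auto
  then have "\<gamma>1 < 20 / 41" "20 / 41 < \<gamma>2" using assms(5) by simp_all
  moreover have "regular a blocks" by (rule reg[OF adm]) simp
  \<comment> \<open>The witnesses are \<open>A = 1\<close> and \<open>B = 82\<close>, that is, two
    periods of \<open>blocks\<close>.\<close>
  moreover have "(0::nat) < 1 \<and> (1::nat) < 82 \<and>
      (\<forall>y\<in>admissible. (\<forall>n. card {i \<in> {n..<n + int 82}. y i \<noteq> blocks i} \<le> 1) \<longrightarrow> regular a y)"
    using reg by simp
  ultimately show ?thesis using adm density_blocks by blast
qed

end
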